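(* Let $I=[0,1]$ and let $x=\sum_{i=1}^ka_i\delta_{t_i}$ be a non-negative $k$-sparse discrete measure with $a_i>0$ and distinct $t_i\in(0,1)$. Let $m\ge2k+1$, let $\{\phi_j\}_{j=1}^m$ form a T-system on $I$, and let $y_j=\int_I\phi_j(t)\,x(dt)$ for $j=1,\dots,m$ (exact measurements). Then $x$ is the unique non-negative Borel measure $z$ on $I$ satisfying $\int_I\phi_j(t)\,z(dt)=y_j$ for all $j=1,\dots,m$.
   Context: Real-valued continuous functions $\{\phi_j\}_{j=1}^m$ form a T-system (Chebyshev system) on $I$ if the $m\times m$ matrix $[\phi_j(\tau_l)]_{l,j=1}^m$ is nonsingular for every increasing sequence $\tau_1<\dots<\tau_m$ in $I$. *)

theory Defs
  imports "HOL-Probability.Probability" "Jordan_Normal_Form.Matrix"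
begin

text \<open>Systems of \<open>m\<close> functions, sequences of \<open>m\<close> points and sums of \<open>k\<close> Dirac
  measures are indexed from 0, matching the matrix library.\<close>

definition T_system :: "nat \<Rightarrow> (nat \<Rightarrow> real \<Rightarrow> real) \<Rightarrow> real set \<Rightarrow> bool" where
  "T_system m \<phi> I \<longleftrightarrow>
     (\<forall>j<m. continuous_on I (\<phi> j)) \<and>
     (\<forall>\<tau>. strict_mono_on {..<m} \<tau> \<and> \<tau> ` {..<m} \<subseteq> I \<longrightarrow>
        invertible_mat (Matrix.mat m m (\<lambda>(l, j). \<phi> j (\<tau> l))))"

abbreviation borel_on :: "real set \<Rightarrow> real measure" where
  "borel_on I \<equiv> restrict_space borel I"

definition borel_measure_on :: "real set \<Rightarrow> real measure \<Rightarrow> bool" where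
  "borel_measure_on I z \<longleftrightarrow> space z = I \<and> sets z = sets (borel_on I)"

text \<open>\<^const>\<open>return\<close> is the library's Dirac measure.\<close>

definition discrete_measure ::
  "real set \<Rightarrow> nat \<Rightarrow> (nat \<Rightarrow> real) \<Rightarrow> (nat \<Rightarrow> real) \<Rightarrow> real measure" where
  "discrete_measure I k a t =
     measure_of I (sets (borel_on I))
       (\<lambda>B. \<Sum>i<k. ennreal (a i) * emeasure (return (borel_on I) (t i)) B)"

text \<open>A set function that is not countably additive would be replaced by 0 in
  \<^const>\<open>measure_of\<close>; the following lemma shows that this does not occur here.\<close>

lemma emeasure_discrete_measure:
  assumes "B \<in> sets (borel_on I)"
  shows "emeasure (discrete_measure I k a t) B =
         (\<Sum>i<k. ennreal (a i) * emeasure (return (borel_on I) (t i)) B)"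
proof -
  let ?\<mu> = "\<lambda>B. \<Sum>i<k. ennreal (a i) * emeasure (return (borel_on I) (t i)) B"
  have sa: "sigma_algebra I (sets (borel_on I))"
    using sets.sigma_algebra_axioms[of "borel_on I"] by (simp add: space_restrict_space)
  have "countably_additive (sets (borel_on I)) ?\<mu>"
    unfolding countably_additive_def
  proof (intro allI impI)
    fix A :: "nat \<Rightarrow> real set"
    assume A: "range A \<subseteq> sets (borel_on I)" "disjoint_family A"
    have "(\<Sum>n. ?\<mu> (A n)) =
          (\<Sum>i<k. \<Sum>n. ennreal (a i) * emeasure (return (borel_on I) (t i)) (A n))"
      by (rule suminf_sum) simp
    also have "\<dots> = ?\<mu> (\<Union>n. A n)"
      using A by (intro sum.cong refl) (simp add: suminf_emeasure del: emeasure_return)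
    finally show "(\<Sum>n. ?\<mu> (A n)) = ?\<mu> (\<Union>n. A n)" .
  qed
  then show ?thesis
    unfolding discrete_measure_def
    by (intro emeasure_measure_of_sigma sa assms) (auto simp: positive_def)
qed

lemma borel_measure_on_discrete_measure: "borel_measure_on I (discrete_measure I k a t)"
proof -
  have sa: "sigma_algebra I (sets (borel_on I))"
    using sets.sigma_algebra_axioms[of "borel_on I"] by (simp add: space_restrict_space)
  show ?thesis
    unfolding borel_measure_on_def discrete_measure_def
    using sigma_algebra.sets_measure_of_eq[OF sa] sigma_algebra.space_measure_of_eq[OF sa]
    by simp
qed

end

theory Submission
  imports Defs
begin

text \<open>
  Write \<open>p\<close> for a generalized polynomial \<open>\<Sum>j<m. c j * \<phi> j\<close> and \<open>K\<close> for the set of the \<open>k\<close> atoms of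
  \<open>x\<close>. The moment conditions say that \<open>z\<close> and \<open>x\<close> give the same integral to every \<open>p\<close>. Suppose that
  some \<open>p\<close> is non-negative on the interval and vanishes exactly on \<open>K\<close>. Then \<open>\<integral>p dz = \<integral>p dx = 0\<close>, so \<open>z\<close>
  lives on \<open>K\<close> as well. Interpolating the indicator function of one point of \<open>K\<close> then shows that
  this point has the same mass under \<open>z\<close> and \<open>x\<close>, hence \<open>z = x\<close>
  (\<open>finitely_supported_measure_determined_by_moments\<close>).

  The work lies in constructing \<open>p\<close>. A nonzero generalized polynomial has fewer than \<open>m\<close> zeros,
  and this remains true when an interior zero without a sign change is counted twice: a
  small perturbation splits every such zero into two (\<open>zero_multiplicity_bound\<close>). Consequently a
  polynomial with \<open>m - 1\<close> prescribed zeros changes sign at each of them in the interior, that is,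
  it has up to a global factor the sign of \<open>\<Prod>s. x - s\<close>
  (\<open>sign_constant_relative_to_zeros\<close>). Prescribe now pairs of zeros \<open>z\<close> and \<open>z + h\<close>, together with
  possible zeros at the endpoints, and let \<open>h\<close> tend to 0. By compactness of the set of normalized
  coefficient vectors, a limit polynomial exists; it has constant sign and double zeros at the
  points \<open>z\<close>, and the counting bound excludes further ones (\<open>nonneg_poly_with_double_zeros\<close>).

  This uses up exactly \<open>m - 1\<close> zeros, whereas \<open>K\<close> accounts only for \<open>2 * k \<le> m - 1\<close> of them. The
  surplus zeros are placed in two disjoint ways; the sum of the two resulting non-negative
  polynomials vanishes exactly on \<open>K\<close> (\<open>nonneg_poly_with_zero_set\<close>).
\<close>

section \<open>Zeros and interpolation in T-systems\<close>

definition gen_poly :: "nat \<Rightarrow> (nat \<Rightarrow> real \<Rightarrow> real) \<Rightarrow> (nat \<Rightarrow> real) \<Rightarrow> real \<Rightarrow> real" where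
  "gen_poly m \<phi> c s = (\<Sum>j<m. c j * \<phi> j s)"

lemma gen_poly_add: "gen_poly m \<phi> (\<lambda>j. c j + d j) s = gen_poly m \<phi> c s + gen_poly m \<phi> d s"
  by (simp add: gen_poly_def algebra_simps sum.distrib)

lemma gen_poly_scale: "gen_poly m \<phi> (\<lambda>j. r * c j) s = r * gen_poly m \<phi> c s"
  by (simp add: gen_poly_def sum_distrib_left mult.assoc)

lemma gen_poly_nonzeroD: "gen_poly m \<phi> c s \<noteq> 0 \<Longrightarrow> \<exists>j<m. c j \<noteq> 0"
  unfolding gen_poly_def by (metis (mono_tags, lifting) lessThan_iff mult_eq_0_iff sum.neutral)

lemma continuous_on_gen_poly:
  assumes "T_system m \<phi> I"
  shows "continuous_on I (gen_poly m \<phi> c)"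
  using assms unfolding gen_poly_def T_system_def by (auto intro!: continuous_intros)

text \<open>
  The matrix \<open>A\<close> maps coefficients to the values of the polynomial at the points of \<open>S\<close>. Its
  left inverse gives the bound on the number of zeros, its right inverse gives interpolation.
\<close>

lemma T_system_collocation:
  assumes T: "T_system m \<phi> I" and S: "finite S" "S \<subseteq> I" "card S = m"
  obtains \<tau> A B where "\<tau> ` {..<m} = S" "inj_on \<tau> {..<m}"
    "A = Matrix.mat m m (\<lambda>(l, j). \<phi> j (\<tau> l))" "B \<in> carrier_mat m m"
    "A * B = 1\<^sub>m m" "B * A = 1\<^sub>m m"
proof -
  define \<tau> where "\<tau> = (!) (sorted_list_of_set S)"
  have \<tau>: "bij_betw \<tau> {..<m} S" "strict_mono_on {..<m} \<tau>"
    using S sorted_wrt_nth_less[OF strict_sorted_list_of_set[of S]]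
    by (auto simp: \<tau>_def intro!: bij_betw_nth strict_mono_onI)
  define A where "A = Matrix.mat m m (\<lambda>(l, j). \<phi> j (\<tau> l))"
  have A: "A \<in> carrier_mat m m" by (simp add: A_def)
  have "\<tau> ` {..<m} = S" using \<tau>(1) by (simp add: bij_betw_def)
  with T \<tau>(2) S(2) have "invertible_mat A" unfolding T_system_def A_def by blast
  then obtain B where AB: "A * B = 1\<^sub>m m" and BA: "B * A = 1\<^sub>m (dim_row B)"
    using A unfolding invertible_mat_def inverts_mat_def by auto
  have "dim_col B = m" using arg_cong[OF AB, of dim_col] by simp
  moreover have "dim_row B = m" using arg_cong[OF BA, of dim_col] A by simp
  ultimately have "B \<in> carrier_mat m m" by auto
  with AB BA \<open>dim_row B = m\<close> show ?thesis
    using that[of \<tau> A B] \<tau>(1) A_def by (auto simp: bij_betw_def)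
qed

lemma collocation_mult_vec:
  assumes "A = Matrix.mat m m (\<lambda>(l, j). \<phi> j (\<tau> l))" "l < m"
  shows "vec_index (A *\<^sub>v Matrix.vec m c) l = gen_poly m \<phi> c (\<tau> l)"
  using assms by (auto simp: gen_poly_def scalar_prod_def lessThan_atLeast0 mult.commute intro!: sum.cong)

lemma T_system_zeros:
  assumes T: "T_system m \<phi> I" and nz: "\<exists>j<m. c j \<noteq> 0"
    and S: "S \<subseteq> I" "\<And>s. s \<in> S \<Longrightarrow> gen_poly m \<phi> c s = 0"
  shows "finite S \<and> card S < m"
proof (rule ccontr)
  assume *: "\<not> (finite S \<and> card S < m)"
  have "\<exists>S'\<subseteq>S. finite S' \<and> card S' = m"
  proof (cases "finite S")
    case True
    with * show ?thesis by (meson not_less obtain_subset_with_card_n)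
  next
    case False
    then show ?thesis using infinite_arbitrarily_large by blast
  qed
  then obtain S' where S': "S' \<subseteq> S" "finite S'" "card S' = m" by blast
  obtain \<tau> A B where \<tau>: "\<tau> ` {..<m} = S'"
    and A: "A = Matrix.mat m m (\<lambda>(l, j). \<phi> j (\<tau> l))"
    and B: "B \<in> carrier_mat m m" "B * A = 1\<^sub>m m"
    by (rule T_system_collocation[OF T S'(2) _ S'(3)]) (use S' S in auto)
  let ?v = "Matrix.vec m c"
  have Ac: "A \<in> carrier_mat m m" by (simp add: A)
  have "A *\<^sub>v ?v = 0\<^sub>v m"
  proof (rule eq_vecI)
    fix l assume "l < dim_vec (0\<^sub>v m :: real Matrix.vec)"
    then have l: "l < m" by simp
    with \<tau> S'(1) have "\<tau> l \<in> S" by auto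
    then show "vec_index (A *\<^sub>v ?v) l = vec_index (0\<^sub>v m) l"
      using collocation_mult_vec[OF A l] S(2) l by simp
  qed (simp add: A)
  then have "(B * A) *\<^sub>v ?v = B *\<^sub>v 0\<^sub>v m"
    using assoc_mult_mat_vec[OF B(1) Ac, of ?v] by simp
  also have "\<dots> = 0\<^sub>v m" using B(1) by auto
  finally have "?v = 0\<^sub>v m" by (simp add: B(2))
  then have "c j = 0" if "j < m" for j using that by (metis index_vec index_zero_vec(1))
  with nz show False by blast
qed

text \<open>
  An infinite set \<open>I\<close> allows \<open>S\<close> to be enlarged to exactly \<open>m\<close> nodes, where the collocation matrix
  is invertible.
\<close>

lemma T_system_interpolation:
  assumes T: "T_system m \<phi> I" and "infinite I"
    and S: "finite S" "S \<subseteq> I" "card S \<le> m"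
  obtains c where "\<And>s. s \<in> S \<Longrightarrow> gen_poly m \<phi> c s = f s"
proof -
  obtain S' where S': "finite S'" "card S' = m" "S \<subseteq> S'" "S' \<subseteq> I"
  proof -
    have "infinite (I - S)" using \<open>infinite I\<close> S(1) by simp
    then obtain D where D: "D \<subseteq> I - S" "finite D" "card D = m - card S"
      using infinite_arbitrarily_large by blast
    then have "card (S \<union> D) = m" using S by (subst card_Un_disjoint) auto
    with D S show ?thesis by (intro that[of "S \<union> D"]) auto
  qed
  obtain \<tau> A B where \<tau>: "\<tau> ` {..<m} = S'"
    and A: "A = Matrix.mat m m (\<lambda>(l, j). \<phi> j (\<tau> l))"
    and B: "B \<in> carrier_mat m m" "A * B = 1\<^sub>m m"
    by (rule T_system_collocation[OF T S'(1) S'(4) S'(2)]) auto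
  have Ac: "A \<in> carrier_mat m m" by (simp add: A)
  define b where "b = Matrix.vec m (\<lambda>l. f (\<tau> l))"
  define c where "c = vec_index (B *\<^sub>v b)"
  have c: "Matrix.vec m c = B *\<^sub>v b" using B(1) by (auto simp: c_def)
  have "A *\<^sub>v Matrix.vec m c = (A * B) *\<^sub>v b"
    unfolding c by (rule assoc_mult_mat_vec[OF Ac B(1), symmetric]) (simp add: b_def)
  also have "\<dots> = b" by (simp add: B(2) b_def)
  finally have Ab: "A *\<^sub>v Matrix.vec m c = b" .
  show ?thesis
  proof (rule that)
    fix s assume "s \<in> S"
    with S'(3) \<tau> obtain l where l: "l < m" "s = \<tau> l" by blast
    show "gen_poly m \<phi> c s = f s"
      using collocation_mult_vec[OF A l(1), of c] Ab l by (simp add: b_def)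
  qed
qed

section \<open>Zeros counted with multiplicity\<close>

text \<open>
  At a zero \<open>z\<close> without a sign change, \<open>p\<close> looks like a valley (\<open>\<sigma> = 1\<close>) or a peak (\<open>\<sigma> = -1\<close>)
  touching the level 0. Let \<open>q\<close> be a polynomial with \<open>q z = \<sigma> z\<close> on \<open>Z\<close> and \<open>q = 0\<close> on \<open>S - Z\<close>. For a small
  \<open>\<epsilon> > 0\<close> the polynomial \<open>p - \<epsilon> q\<close> keeps the zeros in \<open>S - Z\<close> and crosses the level 0 on both sides
  of every \<open>z\<close>. It therefore has \<open>card S + card Z\<close> different zeros, of which there are fewer than
  \<open>m\<close>.
\<close>

lemma zero_multiplicity_bound:
  assumes T: "T_system m \<phi> {\<alpha>..\<beta>}" and nz: "\<exists>j<m. c j \<noteq> 0"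
    and S: "S \<subseteq> {\<alpha>..\<beta>}" and zero: "\<And>s. s \<in> S \<Longrightarrow> gen_poly m \<phi> c s = 0"
    and Z: "Z \<subseteq> S \<inter> {\<alpha><..<\<beta>}"
    and touch: "\<And>z. z \<in> Z \<Longrightarrow>
      \<exists>\<sigma>\<in>{1, -1}. eventually (\<lambda>x. 0 \<le> \<sigma> * gen_poly m \<phi> c x) (at z)"
  shows "card S + card Z < m"
proof (cases "Z = {}")
  case True
  then show ?thesis using T_system_zeros[OF T nz S zero] by simp
next
  case False
  let ?p = "gen_poly m \<phi> c"
  have finS: "finite S" and cardS: "card S < m"
    using T_system_zeros[OF T nz S zero] by auto
  have finZ: "finite Z" using finS Z finite_subset by blast
  have infI: "infinite {\<alpha>..\<beta>}" using False Z by (auto simp: infinite_Icc)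
  define N where "N = {x \<in> {\<alpha>..\<beta>}. ?p x = 0}"
  have finN: "finite N"
    by (rule conjunct1[OF T_system_zeros[OF T nz]]) (auto simp: N_def)
  obtain \<sigma> where \<sigma>: "\<And>z. z \<in> Z \<Longrightarrow> \<sigma> z \<in> {1, -1 :: real}"
      "\<And>z. z \<in> Z \<Longrightarrow> eventually (\<lambda>x. 0 \<le> \<sigma> z * ?p x) (at z)"
    using bchoice[of Z "\<lambda>z \<sigma>. \<sigma> \<in> {1, -1} \<and> eventually (\<lambda>x. 0 \<le> \<sigma> * ?p x) (at z)"] touch by blast
  \<comment> \<open>In a punctured neighbourhood of \<open>z\<close> the sign of \<open>p\<close> is strict, because \<open>p\<close> has only finitely many
    zeros. That its points are closer to \<open>z\<close> than to the rest of \<open>S\<close> keeps the new zeros apart.\<close>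
  have "\<exists>\<delta>>0. \<forall>x. x \<noteq> z \<and> dist x z < \<delta> \<longrightarrow>
      x \<in> {\<alpha>..\<beta>} \<and> 0 < \<sigma> z * ?p x \<and> (\<forall>s\<in>S-{z}. \<bar>x - z\<bar> < \<bar>x - s\<bar>)" if z: "z \<in> Z" for z
  proof -
    have 1: "eventually (\<lambda>x. x \<in> {\<alpha><..<\<beta>}) (at z)"
      using Z z by (intro eventually_at_in_open') auto
    have 2: "eventually (\<lambda>x. \<forall>s\<in>S-{z}. \<bar>x - z\<bar> < \<bar>x - s\<bar>) (at z)"
    proof (intro eventually_ball_finite ballI)
      fix s assume "s \<in> S - {z}"
      then have "\<bar>z - z\<bar> < \<bar>z - s\<bar>" by simp
      moreover have "((\<lambda>x. \<bar>x - s\<bar> - \<bar>x - z\<bar>) \<longlongrightarrow> \<bar>z - s\<bar> - \<bar>z - z\<bar>) (at z)"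
        by (intro tendsto_intros)
      ultimately have "eventually (\<lambda>x. 0 < \<bar>x - s\<bar> - \<bar>x - z\<bar>) (at z)"
        by (intro order_tendstoD(1)) auto
      then show "eventually (\<lambda>x. \<bar>x - z\<bar> < \<bar>x - s\<bar>) (at z)"
        by eventually_elim simp
    qed (use finS in simp)
    have 3: "eventually (\<lambda>x. \<forall>n\<in>N. x \<noteq> n) (at z)"
      using finN by (intro eventually_ball_finite ballI eventually_neq_at_within)
    have "eventually (\<lambda>x. x \<in> {\<alpha>..\<beta>} \<and> 0 < \<sigma> z * ?p x \<and>
        (\<forall>s\<in>S-{z}. \<bar>x - z\<bar> < \<bar>x - s\<bar>)) (at z)"
      using 1 2 3 \<sigma>(2)[OF z]
    proof eventually_elim
      case (elim x)
      then have "?p x \<noteq> 0" unfolding N_def by fastforce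
      with \<sigma>(1)[OF z] elim have "0 < \<sigma> z * ?p x" by fastforce
      with elim show ?case by auto
    qed
    then show ?thesis unfolding eventually_at by auto
  qed
  then obtain \<delta> where \<delta>: "\<And>z. z \<in> Z \<Longrightarrow> 0 < \<delta> z"
    and near: "\<And>z x. z \<in> Z \<Longrightarrow> x \<noteq> z \<Longrightarrow> dist x z < \<delta> z \<Longrightarrow>
      x \<in> {\<alpha>..\<beta>} \<and> 0 < \<sigma> z * ?p x \<and> (\<forall>s\<in>S-{z}. \<bar>x - z\<bar> < \<bar>x - s\<bar>)"
    by metis
  define W where "W = (\<lambda>z. z - \<delta> z / 2) ` Z \<union> (\<lambda>z. z + \<delta> z / 2) ` Z"
  obtain d where d: "\<And>s. s \<in> S \<Longrightarrow> gen_poly m \<phi> d s = (if s \<in> Z then \<sigma> s else 0)"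
    by (rule T_system_interpolation[OF T infI finS S, where f = "\<lambda>s. if s \<in> Z then \<sigma> s else 0"])
       (use cardS in auto)
  let ?q = "gen_poly m \<phi> d"
  \<comment> \<open>It suffices that the perturbation does not change the sign of \<open>p\<close> at the two points on either
    side of each \<open>z\<close> that are collected in \<open>W\<close>.\<close>
  have "eventually (\<lambda>\<epsilon>. \<forall>w\<in>W. \<epsilon> * \<bar>?q w\<bar> < \<bar>?p w\<bar>) (at_right 0)"
  proof (intro eventually_ball_finite ballI)
    fix w assume "w \<in> W"
    then obtain z where z: "z \<in> Z" "w = z - \<delta> z / 2 \<or> w = z + \<delta> z / 2"
      by (auto simp: W_def)
    have "?p w \<noteq> 0" using near[of z w] z \<delta>[of z] by (auto simp: dist_real_def)
    moreover have "((\<lambda>\<epsilon>. \<epsilon> * \<bar>?q w\<bar>) \<longlongrightarrow> 0 * \<bar>?q w\<bar>) (at_right 0)"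
      by (intro tendsto_intros)
    ultimately show "eventually (\<lambda>\<epsilon>. \<epsilon> * \<bar>?q w\<bar> < \<bar>?p w\<bar>) (at_right 0)"
      by (intro order_tendstoD(2)) auto
  qed (use finZ in \<open>simp add: W_def\<close>)
  moreover have "eventually (\<lambda>\<epsilon>::real. 0 < \<epsilon>) (at_right 0)"
    by (rule eventually_at_right_less)
  ultimately have "eventually (\<lambda>\<epsilon>. 0 < \<epsilon> \<and> (\<forall>w\<in>W. \<epsilon> * \<bar>?q w\<bar> < \<bar>?p w\<bar>)) (at_right 0)"
    by eventually_elim simp
  then obtain \<epsilon> where \<epsilon>: "0 < \<epsilon>" "\<And>w. w \<in> W \<Longrightarrow> \<epsilon> * \<bar>?q w\<bar> < \<bar>?p w\<bar>"
    using eventually_happens[of _ "at_right (0::real)"] trivial_limit_at_right_real by blast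
  define e where "e = (\<lambda>j. c j + (- \<epsilon>) * d j)"
  let ?r = "gen_poly m \<phi> e"
  have r: "?r x = ?p x - \<epsilon> * ?q x" for x
    unfolding e_def gen_poly_add gen_poly_scale by simp
  have contr: "continuous_on {\<alpha>..\<beta>} (\<lambda>x. \<sigma> z * ?r x)" for z
    by (intro continuous_intros continuous_on_gen_poly T)
  have rz: "\<sigma> z * ?r z < 0" if "z \<in> Z" for z
  proof -
    have "z \<in> S" using that Z by auto
    then show ?thesis using \<sigma>(1)[OF that] \<epsilon>(1) zero d that by (auto simp: r)
  qed
  have rw: "0 < \<sigma> z * ?r w" if "z \<in> Z" "w = z - \<delta> z / 2 \<or> w = z + \<delta> z / 2" for z w
  proof -
    have "w \<in> W" using that by (auto simp: W_def)
    note \<epsilon>(2)[OF this]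
    moreover have "0 < \<sigma> z * ?p w" using near[of z w] that \<delta>[of z] by (auto simp: dist_real_def)
    moreover have "\<bar>\<epsilon> * ?q w\<bar> = \<epsilon> * \<bar>?q w\<bar>" using \<epsilon>(1) by (simp add: abs_mult)
    ultimately show ?thesis using \<sigma>(1)[OF that(1)] by (auto simp: r)
  qed
  have nzr: "\<exists>j<m. e j \<noteq> 0"
  proof -
    obtain z where "z \<in> Z" using False by blast
    then have "?r z \<noteq> 0" using rz[of z] by auto
    then show ?thesis by (rule gen_poly_nonzeroD)
  qed
  have sub: "{z - \<delta> z / 2..z + \<delta> z / 2} \<subseteq> {\<alpha>..\<beta>}" if "z \<in> Z" for z
    using near[OF that, of "z - \<delta> z / 2"] near[OF that, of "z + \<delta> z / 2"] \<delta>[OF that]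
    by (auto simp: dist_real_def)
  have "\<exists>x. z - \<delta> z / 2 \<le> x \<and> x \<le> z \<and> \<sigma> z * ?r x = 0" if z: "z \<in> Z" for z
    using rz[OF z] rw[OF z] \<delta>[OF z] sub[OF z]
    by (intro IVT2' continuous_on_subset[OF contr]) (auto intro: less_imp_le)
  then obtain L where L: "\<And>z. z \<in> Z \<Longrightarrow> z - \<delta> z / 2 \<le> L z \<and> L z \<le> z \<and> \<sigma> z * ?r (L z) = 0"
    by metis
  have "\<exists>x. z \<le> x \<and> x \<le> z + \<delta> z / 2 \<and> \<sigma> z * ?r x = 0" if z: "z \<in> Z" for z
    using rz[OF z] rw[OF z] \<delta>[OF z] sub[OF z]
    by (intro IVT' continuous_on_subset[OF contr]) (auto intro: less_imp_le)
  then obtain R where R: "\<And>z. z \<in> Z \<Longrightarrow> z \<le> R z \<and> R z \<le> z + \<delta> z / 2 \<and> \<sigma> z * ?r (R z) = 0"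
    by metis
  have L': "L z < z" "dist (L z) z < \<delta> z" "?r (L z) = 0" if "z \<in> Z" for z
    using L[OF that] rz[OF that] \<sigma>(1)[OF that] \<delta>[OF that]
    by (auto simp: dist_real_def order.order_iff_strict)
  have R': "z < R z" "dist (R z) z < \<delta> z" "?r (R z) = 0" if "z \<in> Z" for z
    using R[OF that] rz[OF that] \<sigma>(1)[OF that] \<delta>[OF that]
    by (auto simp: dist_real_def order.order_iff_strict)
  have closer: "\<bar>x - z\<bar> < \<bar>x - s\<bar>"
    if "x = L z \<or> x = R z" "z \<in> Z" "s \<in> S" "s \<noteq> z" for x z s
    using near[of z x] L'[of z] R'[of z] that by auto
  have ZS: "z \<in> S" if "z \<in> Z" for z using that Z by blast
  have "inj_on L Z"
  proof (rule inj_onI, rule ccontr)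
    fix z z' assume "z \<in> Z" "z' \<in> Z" "L z = L z'" "z \<noteq> z'"
    then show False using closer[of "L z" z z'] closer[of "L z" z' z] ZS by auto
  qed
  moreover have "inj_on R Z"
  proof (rule inj_onI, rule ccontr)
    fix z z' assume "z \<in> Z" "z' \<in> Z" "R z = R z'" "z \<noteq> z'"
    then show False using closer[of "R z" z z'] closer[of "R z" z' z] ZS by auto
  qed
  moreover have LR: "L ` Z \<inter> R ` Z = {}"
  proof -
    have "L z \<noteq> R z'" if "z \<in> Z" "z' \<in> Z" for z z'
      using closer[of "L z" z z'] closer[of "R z'" z' z] L'(1)[of z] R'(1)[of z'] that ZS
      by (cases "z = z'") auto
    then show ?thesis by auto
  qed
  moreover have LRS: "(S - Z) \<inter> (L ` Z \<union> R ` Z) = {}"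
  proof -
    have "L z \<notin> S - Z" "R z \<notin> S - Z" if "z \<in> Z" for z
      using closer[of "L z" z "L z"] closer[of "R z" z "R z"] that L'(1)[of z] R'(1)[of z] by auto
    then show ?thesis by blast
  qed
  ultimately have card: "card ((S - Z) \<union> (L ` Z \<union> R ` Z)) = card (S - Z) + (card Z + card Z)"
    using finS finZ by (simp add: card_Un_disjoint card_image)
  have "card ((S - Z) \<union> (L ` Z \<union> R ` Z)) < m"
  proof -
    have "(S - Z) \<union> (L ` Z \<union> R ` Z) \<subseteq> {\<alpha>..\<beta>}"
    proof -
      have "L z \<in> {\<alpha>..\<beta>}" "R z \<in> {\<alpha>..\<beta>}" if "z \<in> Z" for z
        using near[OF that, of "L z"] near[OF that, of "R z"] L'[OF that] R'[OF that] by auto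
      then show ?thesis using S by blast
    qed
    moreover have "?r s = 0" if "s \<in> (S - Z) \<union> (L ` Z \<union> R ` Z)" for s
      using that L'(3) R'(3) zero d by (auto simp: r)
    ultimately show ?thesis using T_system_zeros[OF T nzr] by blast
  qed
  moreover have "card (S - Z) = card S - card Z" "card Z \<le> card S"
    using finS finZ ZS by (auto intro!: card_Diff_subset card_mono)
  ultimately show ?thesis using card by simp
qed

section \<open>Signs of polynomials with the maximal number of zeros\<close>

text \<open>
  The product records the parity of the number of zeros on one side: it changes sign at every
  \<open>s \<in> S\<close>. So does the polynomial at the interior ones, because a zero without a sign change would
  raise the count of zeros from \<open>m - 1\<close> to \<open>m\<close>.
\<close>

lemma sign_constant_relative_to_zeros:
  assumes T: "T_system m \<phi> {\<alpha>..\<beta>}" and nz: "\<exists>j<m. c j \<noteq> 0"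
    and S: "finite S" "S \<subseteq> {\<alpha>..\<beta>}" "card S + 1 = m"
    and zero: "\<And>s. s \<in> S \<Longrightarrow> gen_poly m \<phi> c s = 0"
    and xy: "x \<in> {\<alpha>..\<beta>}" "y \<in> {\<alpha>..\<beta>}"
  shows "0 \<le> (gen_poly m \<phi> c x * (\<Prod>s\<in>S. x - s)) * (gen_poly m \<phi> c y * (\<Prod>s\<in>S. y - s))"
proof -
  let ?p = "gen_poly m \<phi> c"
  define g where "g = (\<lambda>x. ?p x * (\<Prod>s\<in>S. x - s))"
  have contg: "continuous_on {\<alpha>..\<beta>} g"
    unfolding g_def by (intro continuous_intros continuous_on_gen_poly T)
  have p0: "x \<in> S" if "x \<in> {\<alpha>..\<beta>}" "?p x = 0" for x
  proof (rule ccontr)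
    assume "x \<notin> S"
    have "card (insert x S) < m"
      by (rule conjunct2[OF T_system_zeros[OF T nz]]) (use S zero that in auto)
    then show False using S \<open>x \<notin> S\<close> by simp
  qed
  have g0: "g x = 0 \<longleftrightarrow> x \<in> S" if "x \<in> {\<alpha>..\<beta>}" for x
    using p0[OF that] zero S(1) by (auto simp: g_def)
  have same_piece: "0 < g u * g v"
    if "\<alpha> \<le> u" "u \<le> v" "v \<le> \<beta>" "S \<inter> {u..v} = {}" for u v
  proof (rule ccontr)
    assume "\<not> 0 < g u * g v"
    moreover have "u \<notin> S" "v \<notin> S" using that by auto
    then have "g u \<noteq> 0" "g v \<noteq> 0" using g0[of u] g0[of v] that by auto
    ultimately have "g u \<le> 0 \<and> 0 \<le> g v \<or> 0 \<le> g u \<and> g v \<le> 0"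
      by (auto simp: zero_less_mult_iff not_less)
    moreover have "continuous_on {u..v} g"
      by (rule continuous_on_subset[OF contg]) (use that in auto)
    ultimately obtain w where "u \<le> w" "w \<le> v" "g w = 0"
      using IVT'[of g u 0 v] IVT2'[of g v 0 u] \<open>u \<le> v\<close> by blast
    then show False using g0[of w] that by auto
  qed
  have cross: "0 < g u * g v"
    if uv: "\<alpha> \<le> u" "u < s" "s < v" "v \<le> \<beta>" "S \<inter> {u..v} = {s}" for u v s
  proof (rule ccontr)
    assume neg: "\<not> 0 < g u * g v"
    define h where "h = (\<lambda>x. \<Prod>s\<in>S-{s}. x - s)"
    have s: "s \<in> S" using uv(5) by blast
    have gh: "g x = ?p x * ((x - s) * h x)" for x
      unfolding g_def h_def using prod.remove[OF S(1) s, of "\<lambda>s. x - s"] by simp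
    define \<sigma> where "\<sigma> = sgn (?p u)"
    have notS: "x \<notin> S" if "x \<in> {u..v}" "x \<noteq> s" for x using uv(5) that by blast
    have p_nz: "?p x \<noteq> 0" if "x \<in> {u..v}" "x \<noteq> s" for x
      using p0[of x] notS[OF that] that uv(1,4) by auto
    have h_nz: "h x \<noteq> 0" if "x \<in> {u..v}" for x
      using S(1) notS[OF that] by (auto simp: h_def)
    have conth: "continuous_on {u..v} h" unfolding h_def by (intro continuous_intros)
    have hh: "0 < h u * h v"
    proof (rule ccontr)
      assume "\<not> 0 < h u * h v"
      then have "h u \<le> 0 \<and> 0 \<le> h v \<or> 0 \<le> h u \<and> h v \<le> 0"
        by (auto simp: zero_less_mult_iff not_less)
      then obtain w where "u \<le> w" "w \<le> v" "h w = 0"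
        using IVT'[of h u 0 v] IVT2'[of h v 0 u] uv(2,3) conth by fastforce
      then show False using h_nz[of w] by auto
    qed
    have "g u * g v = (?p u * ?p v) * ((h u * h v) * ((u - s) * (v - s)))"
      unfolding gh by (simp add: mult_ac)
    moreover have "(h u * h v) * ((u - s) * (v - s)) < 0"
      using hh uv(2,3) by (simp add: mult_pos_neg mult_neg_pos)
    ultimately have "0 \<le> ?p u * ?p v" using neg
      by (metis mult_neg_neg not_less)
    moreover have pu: "?p u \<noteq> 0" and pv: "?p v \<noteq> 0" using p_nz uv(2,3) by auto
    ultimately have puv: "0 < \<sigma> * ?p u" "0 < \<sigma> * ?p v"
      by (auto simp: \<sigma>_def sgn_real_def zero_le_mult_iff)
    have \<sigma>: "\<sigma> \<in> {1, -1}" using pu by (auto simp: \<sigma>_def sgn_real_def)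
    have contp: "continuous_on {\<alpha>..\<beta>} (\<lambda>x. \<sigma> * ?p x)"
      by (intro continuous_intros continuous_on_gen_poly T)
    have pos: "0 \<le> \<sigma> * ?p x" if x: "x \<in> {u<..<v}" "x \<noteq> s" for x
    proof (rule ccontr)
      assume "\<not> 0 \<le> \<sigma> * ?p x"
      then have neg: "\<sigma> * ?p x \<le> 0" by simp
      show False
      proof (cases "x < s")
        case True
        have "continuous_on {u..x} (\<lambda>x. \<sigma> * ?p x)"
          by (rule continuous_on_subset[OF contp]) (use uv(1-4) x in auto)
        then obtain w where "u \<le> w" "w \<le> x" "\<sigma> * ?p w = 0"
          using IVT2'[of "\<lambda>x. \<sigma> * ?p x" x 0 u] neg puv x by auto
        then show False using p_nz[of w] \<sigma> True x uv(2,3) by auto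
      next
        case False
        have "continuous_on {x..v} (\<lambda>x. \<sigma> * ?p x)"
          by (rule continuous_on_subset[OF contp]) (use uv(1-4) x in auto)
        then obtain w where "x \<le> w" "w \<le> v" "\<sigma> * ?p w = 0"
          using IVT'[of "\<lambda>x. \<sigma> * ?p x" x 0 v] neg puv x by auto
        then show False using p_nz[of w] \<sigma> False x uv(2,3) by auto
      qed
    qed
    have "card S + card {s} < m"
    proof (rule zero_multiplicity_bound[OF T nz S(2) zero])
      show "{s} \<subseteq> S \<inter> {\<alpha><..<\<beta>}" using s uv(1-4) by auto
      fix z assume "z \<in> {s}"
      then have z: "z = s" by simp
      have "eventually (\<lambda>x. x \<in> {u<..<v} - {s}) (at s)"
        using uv(2,3) eventually_at_in_open[of "{u<..<v}" s] by simp
      then have "eventually (\<lambda>x. 0 \<le> \<sigma> * ?p x) (at s)"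
        by eventually_elim (use pos in auto)
      then show "\<exists>\<sigma>\<in>{1, -1}. eventually (\<lambda>x. 0 \<le> \<sigma> * ?p x) (at z)"
        using \<sigma> z by blast
    qed
    then show False using S by simp
  qed
  \<comment> \<open>The rightmost zero in the interval is split off, by a point \<open>v'\<close> between it and its predecessor.\<close>
  have main: "0 < g u * g v"
    if "\<alpha> \<le> u" "u \<le> v" "v \<le> \<beta>" "u \<notin> S" "v \<notin> S" for u v
    using that
  proof (induction "card (S \<inter> {u..v})" arbitrary: v rule: less_induct)
    case (less v)
    show ?case
    proof (cases "S \<inter> {u..v} = {}")
      case True
      then show ?thesis using same_piece less.prems by blast
    next
      case False
      define s where "s = Max (S \<inter> {u..v})"
      have fin: "finite (S \<inter> {u..v})" using S(1) by simp
      have s: "s \<in> S \<inter> {u..v}" unfolding s_def by (rule Max_in[OF fin False])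
      have smax: "r \<le> s" if "r \<in> S \<inter> {u..v}" for r
        unfolding s_def by (rule Max_ge[OF fin that])
      define w where "w = Max (insert u (S \<inter> {u..v} - {s}))"
      have w: "w \<in> insert u (S \<inter> {u..v} - {s})" unfolding w_def by (rule Max_in) (use fin in auto)
      have wmax: "r \<le> w" if "r \<in> insert u (S \<inter> {u..v} - {s})" for r
        unfolding w_def by (rule Max_ge) (use that fin in auto)
      have us: "u < s" "s < v" using s less.prems by (auto simp: order.order_iff_strict)
      have ws: "w < s" "u \<le> w" using w us smax[of w] wmax[of u] by auto
      define v' where "v' = (w + s) / 2"
      have v': "w < v'" "v' < s" using ws by (auto simp: v'_def)
      have piece: "S \<inter> {v'..v} = {s}"
      proof (intro equalityI subsetI)
        fix r assume r: "r \<in> S \<inter> {v'..v}"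
        then have "r \<in> S \<inter> {u..v}" using v'(1) ws(2) by auto
        then show "r \<in> {s}" using wmax[of r] r v'(1) by force
      qed (use s v' in auto)
      have "S \<inter> {u..v'} \<subset> S \<inter> {u..v}"
      proof (rule psubsetI)
        show "S \<inter> {u..v'} \<subseteq> S \<inter> {u..v}" using v' us by auto
        have "s \<notin> S \<inter> {u..v'}" using v' by simp
        then show "S \<inter> {u..v'} \<noteq> S \<inter> {u..v}" using s by blast
      qed
      then have "card (S \<inter> {u..v'}) < card (S \<inter> {u..v})"
        using fin psubset_card_mono by blast
      moreover have "v' \<notin> S"
      proof
        assume "v' \<in> S"
        then have "v' \<in> S \<inter> {v'..v}" using v' us by simp
        then show False using piece v' by simp
      qed
      ultimately have "0 < g u * g v'"
        using less.hyps[of v'] less.prems v' ws us by auto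
      moreover have "0 < g v' * g v"
        by (rule cross[OF _ v'(2) us(2) _ piece]) (use less.prems v' ws in auto)
      ultimately show ?thesis
        by (auto simp: zero_less_mult_iff)
    qed
  qed
  have "0 \<le> g x * g y"
  proof (cases "x \<in> S \<or> y \<in> S")
    case True
    then show ?thesis using g0[OF xy(1)] g0[OF xy(2)] by auto
  next
    case False
    then show ?thesis
      using main[of x y] main[of y x] xy by (cases "x \<le> y") (auto simp: mult.commute)
  qed
  then show ?thesis by (simp add: g_def)
qed

text \<open>
  The polynomial arises by interpolating the value 1 at one further point. The normalization of
  the coefficients serves to extract limits.
\<close>

lemma normalized_poly_with_zeros:
  assumes T: "T_system m \<phi> {\<alpha>..\<beta>}" and "\<alpha> < \<beta>"
    and S: "finite S" "S \<subseteq> {\<alpha>..\<beta>}" "card S + 1 = m"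
  obtains c where "(\<Sum>j<m. \<bar>c j\<bar>) = 1" "\<And>s. s \<in> S \<Longrightarrow> gen_poly m \<phi> c s = 0"
    "\<And>x. x \<in> {\<alpha>..\<beta>} \<Longrightarrow> 0 \<le> gen_poly m \<phi> c x * (\<Prod>s\<in>S. x - s)"
proof -
  have inf: "infinite {\<alpha>..\<beta>}" using \<open>\<alpha> < \<beta>\<close> by (simp add: infinite_Icc)
  then obtain w where w: "w \<in> {\<alpha>..\<beta>}" "w \<notin> S" using S(1) by (meson finite_subset subsetI)
  obtain c where c: "\<And>s. s \<in> insert w S \<Longrightarrow> gen_poly m \<phi> c s = (if s = w then 1 else 0)"
    by (rule T_system_interpolation[OF T inf, of "insert w S" "\<lambda>s. if s = w then 1 else 0"])
       (use S w in auto)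
  have nz: "\<exists>j<m. c j \<noteq> 0" by (rule gen_poly_nonzeroD[of m \<phi> c w]) (use c in simp)
  have zero: "gen_poly m \<phi> c s = 0" if "s \<in> S" for s using c[of s] that w by auto
  define \<omega> where "\<omega> = (\<lambda>x. \<Prod>s\<in>S. x - s)"
  define N where "N = (\<Sum>j<m. \<bar>c j\<bar>)"
  have N: "0 < N" using nz by (auto simp: N_def intro!: sum_pos2)
  have \<omega>w: "\<omega> w \<noteq> 0" using w S(1) by (auto simp: \<omega>_def)
  define r where "r = sgn (\<omega> w) / N"
  have r: "\<bar>r\<bar> = 1 / N" using N \<omega>w by (simp add: r_def abs_sgn_eq)
  show ?thesis
  proof (rule that[of "\<lambda>j. r * c j"])
    have "(\<Sum>j<m. \<bar>r * c j\<bar>) = \<bar>r\<bar> * N"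
      by (simp add: N_def abs_mult sum_distrib_left)
    then show "(\<Sum>j<m. \<bar>r * c j\<bar>) = 1" using r N by simp
    show "gen_poly m \<phi> (\<lambda>j. r * c j) s = 0" if "s \<in> S" for s
      using zero[OF that] by (simp add: gen_poly_scale)
    fix x assume x: "x \<in> {\<alpha>..\<beta>}"
    have "0 \<le> (gen_poly m \<phi> c x * \<omega> x) * \<omega> w"
      using sign_constant_relative_to_zeros[OF T nz S zero x w(1)] c[of w]
      by (simp add: \<omega>_def)
    then have "0 \<le> (gen_poly m \<phi> c x * \<omega> x) * sgn (\<omega> w)"
      by (auto simp: sgn_real_def zero_le_mult_iff)
    then have "0 \<le> (gen_poly m \<phi> c x * \<omega> x) * sgn (\<omega> w) / N" using N by simp
    then show "0 \<le> gen_poly m \<phi> (\<lambda>j. r * c j) x * (\<Prod>s\<in>S. x - s)"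
      unfolding gen_poly_scale r_def \<omega>_def by (simp add: mult_ac)
  qed
qed

lemma bounded_coords_convergent_subsequence:
  fixes c :: "nat \<Rightarrow> nat \<Rightarrow> real"
  assumes "\<And>n j. j < m \<Longrightarrow> \<bar>c n j\<bar> \<le> B"
  obtains r :: "nat \<Rightarrow> nat" and d where "strict_mono r" "\<And>j. j < m \<Longrightarrow> (\<lambda>n. c (r n) j) \<longlonglongrightarrow> d j"
proof -
  have "\<exists>r::nat \<Rightarrow> nat. strict_mono r \<and> (\<forall>j<m. convergent (\<lambda>n. c (r n) j))"
    using assms
  proof (induction m)
    case 0
    show ?case by (auto intro: exI[of _ id] simp: strict_mono_id)
  next
    case (Suc m)
    then obtain r :: "nat \<Rightarrow> nat" where r: "strict_mono r" "\<forall>j<m. convergent (\<lambda>n. c (r n) j)"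
      by auto
    have "bounded (range (\<lambda>n. c (r n) m))"
      using Suc.prems by (auto simp: bounded_iff intro!: exI[of _ B])
    then obtain l s where s: "strict_mono (s :: nat \<Rightarrow> nat)" "((\<lambda>n. c (r n) m) \<circ> s) \<longlonglongrightarrow> l"
      using bounded_imp_convergent_subsequence by blast
    have "convergent (\<lambda>n. c ((r \<circ> s) n) j)" if "j < Suc m" for j
    proof (cases "j = m")
      case True
      then show ?thesis using s(2) by (auto simp: o_def convergent_def)
    next
      case False
      then have "convergent (\<lambda>n. c (r n) j)" using r that by auto
      from convergent_subseq_convergent[OF this s(1)] show ?thesis by (simp add: o_def)
    qed
    then show ?case using strict_mono_o[OF r(1) s(1)] by blast
  qed
  then obtain r :: "nat \<Rightarrow> nat" where r: "strict_mono r" "\<forall>j<m. convergent (\<lambda>n. c (r n) j)"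
    by blast
  show ?thesis
    by (rule that[OF r(1), of "\<lambda>j. lim (\<lambda>n. c (r n) j)"])
       (use r(2) in \<open>simp add: convergent_LIMSEQ_iff\<close>)
qed

section \<open>Non-negative polynomials with prescribed zeros\<close>

lemma gen_poly_tendsto:
  assumes "\<And>j. j < m \<Longrightarrow> (\<lambda>n. c n j) \<longlonglongrightarrow> d j"
  shows "(\<lambda>n. gen_poly m \<phi> (c n) x) \<longlonglongrightarrow> gen_poly m \<phi> d x"
  unfolding gen_poly_def by (intro tendsto_intros assms) auto

text \<open>
  A zero \<open>z \<in> Z\<close> is obtained as the limit of the pair of simple zeros \<open>z\<close>, \<open>z + h n\<close>, between which the
  wrong sign may occur; every other point eventually lies outside all these pairs. Zeros at the
  endpoints are simple and do not affect the sign inside, so that both parities of \<open>m - 1\<close>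
  are covered.
\<close>

lemma nonneg_poly_with_double_zeros:
  assumes T: "T_system m \<phi> {\<alpha>..\<beta>}" and \<alpha>\<beta>: "\<alpha> < \<beta>"
    and Z: "finite Z" "Z \<subseteq> {\<alpha><..<\<beta>}" and E: "E \<subseteq> {\<alpha>, \<beta>}"
    and m: "2 * card Z + card E + 1 = m"
  obtains c where "\<And>x. x \<in> {\<alpha>..\<beta>} \<Longrightarrow> 0 \<le> gen_poly m \<phi> c x"
    "\<And>x. x \<in> {\<alpha>..\<beta>} \<Longrightarrow> gen_poly m \<phi> c x = 0 \<longleftrightarrow> x \<in> Z \<union> E"
proof -
  have finE: "finite E" using E finite_subset by blast
  have "\<exists>h. 0 < h \<and> h < inverse (real (Suc n)) \<and> (\<forall>z\<in>Z. z + h < \<beta> \<and> z + h \<notin> Z)" for n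
  proof -
    have 1: "eventually (\<lambda>h::real. 0 < h) (at_right 0)" by (rule eventually_at_right_less)
    have 2: "eventually (\<lambda>h::real. h < inverse (real (Suc n))) (at_right 0)"
      by (rule order_tendstoD(2)[OF tendsto_ident_at]) simp
    have 3: "eventually (\<lambda>h. \<forall>z\<in>Z. z + h < \<beta> \<and> (\<forall>z'\<in>Z. z + h \<noteq> z')) (at_right 0)"
    proof (intro eventually_ball_finite ballI eventually_conj)
      fix z assume "z \<in> Z"
      then have "z + 0 < \<beta>" using Z(2) by auto
      moreover have "((\<lambda>h. z + h) \<longlongrightarrow> z + 0) (at_right 0)" by (intro tendsto_intros)
      ultimately show "eventually (\<lambda>h. z + h < \<beta>) (at_right 0)" by (intro order_tendstoD(2))
      fix z' assume "z' \<in> Z"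
      show "eventually (\<lambda>h. z + h \<noteq> z') (at_right 0)"
      proof (cases "z = z'")
        case True
        from 1 show ?thesis by eventually_elim (use True in simp)
      next
        case False
        have "eventually (\<lambda>h. h \<noteq> z' - z) (at_right 0)"
          by (rule tendsto_imp_eventually_ne[OF tendsto_ident_at]) (use False in simp)
        then show ?thesis by eventually_elim auto
      qed
    qed (use Z in auto)
    from 1 2 3 have "eventually (\<lambda>h. 0 < h \<and> h < inverse (real (Suc n)) \<and>
        (\<forall>z\<in>Z. z + h < \<beta> \<and> z + h \<notin> Z)) (at_right 0)"
      by eventually_elim auto
    then show ?thesis
      using eventually_happens[of _ "at_right (0::real)"] trivial_limit_at_right_real by blast
  qed
  then obtain h where h: "\<And>n. 0 < h n" "\<And>n. h n < inverse (real (Suc n))"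
    "\<And>n z. z \<in> Z \<Longrightarrow> z + h n < \<beta>" "\<And>n z. z \<in> Z \<Longrightarrow> z + h n \<notin> Z"
    by metis
  have h_lim: "h \<longlonglongrightarrow> 0"
    by (rule tendsto_sandwich[OF _ _ tendsto_const LIMSEQ_inverse_real_of_nat])
       (use h(1,2) in \<open>auto intro!: always_eventually less_imp_le\<close>)
  define S where "S = (\<lambda>n. Z \<union> (\<lambda>z. z + h n) ` Z \<union> E)"
  have disj: "Z \<inter> (\<lambda>z. z + h n) ` Z = {}" "(Z \<union> (\<lambda>z. z + h n) ` Z) \<inter> E = {}" for n
  proof -
    show "Z \<inter> (\<lambda>z. z + h n) ` Z = {}" using h(4) by auto
    have "z \<notin> E" "z + h n \<notin> E" if "z \<in> Z" for z
    proof -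
      have "\<alpha> < z" "z < \<beta>" "\<alpha> < z + h n" "z + h n < \<beta>"
        using that Z(2) h(1)[of n] h(3)[OF that, of n] by (auto intro: add_strict_increasing2 less_imp_le)
      then show "z \<notin> E" "z + h n \<notin> E" using E by auto
    qed
    then show "(Z \<union> (\<lambda>z. z + h n) ` Z) \<inter> E = {}" by blast
  qed
  have S: "finite (S n)" "S n \<subseteq> {\<alpha>..\<beta>}" "card (S n) + 1 = m" for n
  proof -
    show "finite (S n)" using Z finE by (simp add: S_def)
    have "z \<in> {\<alpha>..\<beta>}" "z + h n \<in> {\<alpha>..\<beta>}" if "z \<in> Z" for z
      using that Z(2) h(1)[of n] h(3)[OF that, of n] by force+
    then show "S n \<subseteq> {\<alpha>..\<beta>}" using E \<alpha>\<beta> by (auto simp: S_def)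
    have "card ((\<lambda>z. z + h n) ` Z) = card Z" by (intro card_image) (auto simp: inj_on_def)
    then show "card (S n) + 1 = m"
      using m Z finE disj[of n] by (simp add: S_def card_Un_disjoint)
  qed
  have "\<exists>c. (\<Sum>j<m. \<bar>c j\<bar>) = 1 \<and> (\<forall>s\<in>S n. gen_poly m \<phi> c s = 0) \<and>
      (\<forall>x\<in>{\<alpha>..\<beta>}. 0 \<le> gen_poly m \<phi> c x * (\<Prod>s\<in>S n. x - s))" for n
    by (rule normalized_poly_with_zeros[OF T \<alpha>\<beta> S[of n]]) blast
  then obtain c where c: "\<And>n. (\<Sum>j<m. \<bar>c n j\<bar>) = 1"
    "\<And>n s. s \<in> S n \<Longrightarrow> gen_poly m \<phi> (c n) s = 0"
    "\<And>n x. x \<in> {\<alpha>..\<beta>} \<Longrightarrow> 0 \<le> gen_poly m \<phi> (c n) x * (\<Prod>s\<in>S n. x - s)"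
    by metis
  have "\<bar>c n j\<bar> \<le> 1" if "j < m" for n j
    using member_le_sum[of j "{..<m}" "\<lambda>j. \<bar>c n j\<bar>"] that c(1)[of n] by simp
  then obtain r d where r: "strict_mono r" and d: "\<And>j. j < m \<Longrightarrow> (\<lambda>n. c (r n) j) \<longlonglongrightarrow> d j"
    using bounded_coords_convergent_subsequence[of m c 1] by metis
  have lim: "(\<lambda>n. gen_poly m \<phi> (c (r n)) x) \<longlonglongrightarrow> gen_poly m \<phi> d x" for x
    by (rule gen_poly_tendsto[OF d])
  have "(\<lambda>n. \<Sum>j<m. \<bar>c (r n) j\<bar>) \<longlonglongrightarrow> (\<Sum>j<m. \<bar>d j\<bar>)"
    by (intro tendsto_intros d) auto
  then have "(\<Sum>j<m. \<bar>d j\<bar>) = 1"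
    using c(1) by (simp add: LIMSEQ_const_iff)
  then have nz: "\<exists>j<m. d j \<noteq> 0"
    by (metis abs_zero lessThan_iff sum.neutral zero_neq_one)
  \<comment> \<open>The sign of \<open>\<Prod>e\<in>E. x - e\<close> on the interval: only the factor \<open>x - \<beta>\<close> is negative.\<close>
  define \<kappa> where "\<kappa> = (if \<beta> \<in> E then -1 else 1 :: real)"
  have \<kappa>: "\<kappa> \<in> {1, -1}" by (simp add: \<kappa>_def)
  have signE: "0 < \<kappa> * (\<Prod>e\<in>E. x - e)" if "x \<in> {\<alpha>..\<beta>}" "x \<notin> E" for x
  proof -
    have "E = {} \<or> E = {\<alpha>} \<or> E = {\<beta>} \<or> E = {\<alpha>, \<beta>}" using E by blast
    then show ?thesis using that \<alpha>\<beta>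
      by (elim disjE) (auto simp: \<kappa>_def mult_neg_pos mult_pos_neg order.order_iff_strict)
  qed
  have zero: "gen_poly m \<phi> d x = 0" if "x \<in> Z \<union> E" for x
  proof -
    have "gen_poly m \<phi> (c (r n)) x = 0" for n using c(2)[of x "r n"] that by (auto simp: S_def)
    then show ?thesis using lim[of x] by (simp add: LIMSEQ_const_iff)
  qed
  have nonneg: "0 \<le> \<kappa> * gen_poly m \<phi> d x" if x: "x \<in> {\<alpha>..\<beta>}" for x
  proof (cases "x \<in> Z \<union> E")
    case True
    then show ?thesis using zero by simp
  next
    case False
    have "eventually (\<lambda>n. \<forall>z\<in>Z. 0 < (x - z) * (x - (z + h (r n)))) sequentially"
    proof (intro eventually_ball_finite ballI)
      fix z assume "z \<in> Z"
      then have "x \<noteq> z" using False by auto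
      then have "0 < (x - z) * (x - (z + 0))" by (auto simp: zero_less_mult_iff)
      moreover have "(\<lambda>n. (x - z) * (x - (z + h (r n)))) \<longlonglongrightarrow> (x - z) * (x - (z + 0))"
        using LIMSEQ_subseq_LIMSEQ[OF h_lim r] by (intro tendsto_intros) (simp add: o_def)
      ultimately show "eventually (\<lambda>n. 0 < (x - z) * (x - (z + h (r n)))) sequentially"
        by (intro order_tendstoD(1))
    qed (use Z in simp)
    then have "eventually (\<lambda>n. 0 \<le> \<kappa> * gen_poly m \<phi> (c (r n)) x) sequentially"
    proof eventually_elim
      case (elim n)
      have "(\<Prod>s\<in>S (r n). x - s) = (\<Prod>z\<in>Z. x - z) * (\<Prod>z\<in>Z. x - (z + h (r n))) * (\<Prod>e\<in>E. x - e)"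
        using Z finE disj[of "r n"]
        by (simp add: S_def prod.union_disjoint prod.reindex inj_on_def)
      also have "\<dots> = (\<Prod>z\<in>Z. (x - z) * (x - (z + h (r n)))) * (\<Prod>e\<in>E. x - e)"
        by (simp add: prod.distrib)
      finally have prod: "(\<Prod>s\<in>S (r n). x - s) =
          (\<Prod>z\<in>Z. (x - z) * (x - (z + h (r n)))) * (\<Prod>e\<in>E. x - e)" .
      have "0 < (\<Prod>z\<in>Z. (x - z) * (x - (z + h (r n))))"
        using elim by (intro prod_pos) auto
      then have "0 < \<kappa> * (\<Prod>s\<in>S (r n). x - s)"
        using mult_pos_pos[OF _ signE[OF x]] False unfolding prod mult.left_commute[of \<kappa>] by blast
      then show ?case using c(3)[OF x, of "r n"] \<kappa>
        by (auto simp: zero_le_mult_iff zero_less_mult_iff)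
    qed
    then show ?thesis
      using lim[of x] by (intro tendsto_lowerbound[OF tendsto_mult_left]) auto
  qed
  \<comment> \<open>A further zero would bring the count to \<open>2 * card Z + card E + 1 = m\<close>.\<close>
  have exact: "x \<in> Z \<union> E" if x: "x \<in> {\<alpha>..\<beta>}" "gen_poly m \<phi> d x = 0" for x
  proof (rule ccontr)
    assume nx: "x \<notin> Z \<union> E"
    have ZE: "Z \<union> E \<subseteq> {\<alpha>..\<beta>}" using Z E \<alpha>\<beta> by auto
    have "card (insert x (Z \<union> E)) + card Z < m"
    proof (rule zero_multiplicity_bound[OF T nz])
      fix z assume "z \<in> Z"
      have "eventually (\<lambda>x. x \<in> {\<alpha><..<\<beta>}) (at z)"
        using Z \<open>z \<in> Z\<close> by (intro eventually_at_in_open') auto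
      then have "eventually (\<lambda>x. 0 \<le> \<kappa> * gen_poly m \<phi> d x) (at z)"
        by eventually_elim (use nonneg in auto)
      then show "\<exists>\<sigma>\<in>{1, -1}. eventually (\<lambda>x. 0 \<le> \<sigma> * gen_poly m \<phi> d x) (at z)"
        using \<kappa> by blast
    qed (use x ZE zero Z in auto)
    moreover have "Z \<inter> E = {}" using disj(2)[of 0] by blast
    ultimately show False using nx Z finE m by (simp add: card_Un_disjoint)
  qed
  show ?thesis
  proof (rule that[of "\<lambda>j. \<kappa> * d j"])
    fix x assume x: "x \<in> {\<alpha>..\<beta>}"
    show "0 \<le> gen_poly m \<phi> (\<lambda>j. \<kappa> * d j) x" using nonneg[OF x] by (simp only: gen_poly_scale)
    show "gen_poly m \<phi> (\<lambda>j. \<kappa> * d j) x = 0 \<longleftrightarrow> x \<in> Z \<union> E"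
      using zero exact[OF x] \<kappa> unfolding gen_poly_scale by auto
  qed
qed

text \<open>
  The \<open>m - 1 - 2 * card K\<close> surplus zeros are spent twice, as double zeros in the disjoint sets \<open>U\<close>
  and \<open>V\<close>. If their number is odd, one of them is a simple zero at \<open>\<alpha>\<close> the first time and at \<open>\<beta>\<close> the
  second time. The sum of the two polynomials vanishes where both do, namely on \<open>K\<close>.
\<close>

lemma nonneg_poly_with_zero_set:
  assumes T: "T_system m \<phi> {\<alpha>..\<beta>}" and \<alpha>\<beta>: "\<alpha> < \<beta>"
    and K: "finite K" "K \<subseteq> {\<alpha><..<\<beta>}" "2 * card K + 1 \<le> m"
  obtains c where "\<And>x. x \<in> {\<alpha>..\<beta>} \<Longrightarrow> 0 \<le> gen_poly m \<phi> c x"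
    "\<And>x. x \<in> {\<alpha>..\<beta>} \<Longrightarrow> gen_poly m \<phi> c x = 0 \<longleftrightarrow> x \<in> K"
proof -
  define n where "n = (m - 1 - 2 * card K) div 2"
  have fresh: "\<exists>U. U \<subseteq> {\<alpha><..<\<beta>} - F \<and> finite U \<and> card U = n" if "finite F" for F
  proof -
    have "infinite ({\<alpha><..<\<beta>} - F)" using that \<alpha>\<beta> by (simp add: infinite_Ioo)
    then show ?thesis using infinite_arbitrarily_large by blast
  qed
  obtain U where U: "U \<subseteq> {\<alpha><..<\<beta>} - K" "finite U" "card U = n"
    using fresh[OF K(1)] by blast
  obtain V where V: "V \<subseteq> {\<alpha><..<\<beta>} - (K \<union> U)" "finite V" "card V = n"
    using fresh[of "K \<union> U"] K(1) U(2) by blast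
  \<comment> \<open>Since \<open>2 * card K\<close> is even, the parity of \<open>m - 1\<close> is that of the surplus.\<close>
  define e where "e = (\<lambda>b. if odd (m - 1) then {b} else ({} :: real set))"
  have card: "2 * card (K \<union> W) + card (e b) + 1 = m" if "W = U \<or> W = V" for W b
  proof -
    have "card (K \<union> W) = card K + n"
      using that U V K(1) by (subst card_Un_disjoint) auto
    moreover have "card (e b) = (m - 1 - 2 * card K) mod 2"
      using K(3) by (auto simp: e_def odd_iff_mod_2_eq_one mod2_eq_if)
    moreover have "2 * n + (m - 1 - 2 * card K) mod 2 = m - 1 - 2 * card K"
      by (simp add: n_def)
    ultimately show ?thesis using K(3) by linarith
  qed
  obtain c where c: "\<And>x. x \<in> {\<alpha>..\<beta>} \<Longrightarrow> 0 \<le> gen_poly m \<phi> c x"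
    "\<And>x. x \<in> {\<alpha>..\<beta>} \<Longrightarrow> gen_poly m \<phi> c x = 0 \<longleftrightarrow> x \<in> (K \<union> U) \<union> e \<alpha>"
    by (rule nonneg_poly_with_double_zeros[OF T \<alpha>\<beta> _ _ _ card[of U \<alpha>]])
       (use K U in \<open>auto simp: e_def\<close>)
  obtain d where d: "\<And>x. x \<in> {\<alpha>..\<beta>} \<Longrightarrow> 0 \<le> gen_poly m \<phi> d x"
    "\<And>x. x \<in> {\<alpha>..\<beta>} \<Longrightarrow> gen_poly m \<phi> d x = 0 \<longleftrightarrow> x \<in> (K \<union> V) \<union> e \<beta>"
    by (rule nonneg_poly_with_double_zeros[OF T \<alpha>\<beta> _ _ _ card[of V \<beta>]])
       (use K V in \<open>auto simp: e_def\<close>)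
  have inter: "(K \<union> U \<union> e \<alpha>) \<inter> (K \<union> V \<union> e \<beta>) = K"
    using U V \<alpha>\<beta> by (auto simp: e_def split: if_splits)
  show ?thesis
  proof (rule that[of "\<lambda>j. c j + d j"])
    fix x assume x: "x \<in> {\<alpha>..\<beta>}"
    show "0 \<le> gen_poly m \<phi> (\<lambda>j. c j + d j) x" using c(1)[OF x] d(1)[OF x] by (simp add: gen_poly_add)
    show "gen_poly m \<phi> (\<lambda>j. c j + d j) x = 0 \<longleftrightarrow> x \<in> K"
      using c[OF x] d[OF x] inter by (simp only: gen_poly_add) (auto simp: add_nonneg_eq_0_iff)
  qed
qed

section \<open>Measures with finite support\<close>

lemma measure_eqI_finite_support:
  assumes sets: "sets M = sets N" and K: "finite K" "\<And>p. p \<in> K \<Longrightarrow> {p} \<in> sets M"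
    and AE: "AE s in M. s \<in> K" "AE s in N. s \<in> K"
    and atoms: "\<And>p. p \<in> K \<Longrightarrow> emeasure M {p} = emeasure N {p}"
  shows "M = N"
proof (rule measure_eqI[OF sets])
  fix B assume B: "B \<in> sets M"
  have sub: "C \<in> sets M" if "C \<subseteq> K" for C
  proof -
    have "C = (\<Union>p\<in>C. {p})" by simp
    also have "\<dots> \<in> sets M" using that K finite_subset[OF that K(1)] by (intro sets.finite_UN) auto
    finally show ?thesis .
  qed
  have eq: "emeasure L B = (\<Sum>p\<in>B \<inter> K. emeasure L {p})"
    if L: "sets L = sets M" "AE s in L. s \<in> K" for L
  proof -
    have "emeasure L B = emeasure L (B \<inter> K)"
      by (rule emeasure_eq_AE) (use L B sub[of "B \<inter> K"] in auto)
    also have "\<dots> = (\<Sum>p\<in>B \<inter> K. emeasure L {p})"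
      by (rule emeasure_eq_sum_singleton) (use K L in auto)
    finally show ?thesis .
  qed
  show "emeasure M B = emeasure N B"
    using eq[of M] eq[of N] AE sets atoms by simp
qed

lemma borel_measurable_borel_on:
  assumes z: "borel_measure_on I z" and f: "continuous_on I f"
  shows "f \<in> borel_measurable z"
proof -
  have "f \<in> borel_measurable (borel_on I)"
    using f by (rule borel_measurable_continuous_on_restrict)
  then show ?thesis
    using z measurable_cong_sets[of z "borel_on I" borel borel] by (auto simp: borel_measure_on_def)
qed

lemma singleton_in_borel_measure_on:
  assumes "borel_measure_on I z" "p \<in> I"
  shows "{p} \<in> sets z"
  using assms by (auto simp: borel_measure_on_def sets_restrict_space image_iff intro!: bexI[of _ "{p}"])

lemma integral_gen_poly:
  assumes "\<And>j. j < m \<Longrightarrow> integrable z (\<phi> j)"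
  shows "integrable z (gen_poly m \<phi> c)"
    and "(\<integral>s. gen_poly m \<phi> c s \<partial>z) = (\<Sum>j<m. c j * (\<integral>s. \<phi> j s \<partial>z))"
proof -
  show "integrable z (gen_poly m \<phi> c)" unfolding gen_poly_def using assms by auto
  show "(\<integral>s. gen_poly m \<phi> c s \<partial>z) = (\<Sum>j<m. c j * (\<integral>s. \<phi> j s \<partial>z))"
    unfolding gen_poly_def using assms by (subst Bochner_Integration.integral_sum) auto
qed

text \<open>
  That \<open>z\<close> has finite mass at a point of \<open>K\<close> follows because the indicator function of the
  point agrees almost everywhere with an integrable polynomial.
\<close>

theorem finitely_supported_measure_determined_by_moments:
  assumes T: "T_system m \<phi> {\<alpha>..\<beta>}" and \<alpha>\<beta>: "\<alpha> < \<beta>"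
    and K: "finite K" "K \<subseteq> {\<alpha><..<\<beta>}" "2 * card K + 1 \<le> m"
    and x: "borel_measure_on {\<alpha>..\<beta>} x" "AE s in x. s \<in> K"
    and z: "borel_measure_on {\<alpha>..\<beta>} z"
    and int: "\<And>j. j < m \<Longrightarrow> integrable x (\<phi> j)" "\<And>j. j < m \<Longrightarrow> integrable z (\<phi> j)"
    and moments: "\<And>j. j < m \<Longrightarrow> (\<integral>s. \<phi> j s \<partial>z) = (\<integral>s. \<phi> j s \<partial>x)"
  shows "z = x"
proof -
  have KI: "K \<subseteq> {\<alpha>..\<beta>}" using K by auto
  have same: "(\<integral>s. gen_poly m \<phi> c s \<partial>z) = (\<integral>s. gen_poly m \<phi> c s \<partial>x)" for c
    using integral_gen_poly(2)[of m x \<phi> c] integral_gen_poly(2)[of m z \<phi> c] int moments by simp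
  have meas: "gen_poly m \<phi> c \<in> borel_measurable L" if "borel_measure_on {\<alpha>..\<beta>} L" for c L
    by (rule borel_measurable_borel_on[OF that continuous_on_gen_poly[OF T]])
  have space_z: "space z = {\<alpha>..\<beta>}" using z by (simp add: borel_measure_on_def)
  \<comment> \<open>This polynomial certifies that \<open>z\<close> has no mass outside \<open>K\<close>.\<close>
  obtain c where c: "\<And>s. s \<in> {\<alpha>..\<beta>} \<Longrightarrow> 0 \<le> gen_poly m \<phi> c s"
    "\<And>s. s \<in> {\<alpha>..\<beta>} \<Longrightarrow> gen_poly m \<phi> c s = 0 \<longleftrightarrow> s \<in> K"
    using nonneg_poly_with_zero_set[OF T \<alpha>\<beta> K] by blast
  have "(\<integral>s. gen_poly m \<phi> c s \<partial>x) = 0"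
  proof (rule integral_eq_zero_AE)
    show "AE s in x. gen_poly m \<phi> c s = 0" using x(2)
      by eventually_elim (use c(2) KI in auto)
  qed
  then have "(\<integral>s. gen_poly m \<phi> c s \<partial>z) = 0" using same by simp
  moreover have "AE s in z. 0 \<le> gen_poly m \<phi> c s"
    by (rule AE_I2) (use c(1) space_z in auto)
  ultimately have "AE s in z. gen_poly m \<phi> c s = 0"
    using integral_nonneg_eq_0_iff_AE[OF integral_gen_poly(1)[of m z \<phi> c]] int(2) by blast
  moreover have "AE s in z. s \<in> {\<alpha>..\<beta>}" by (rule AE_I2) (simp add: space_z)
  ultimately have zK: "AE s in z. s \<in> K"
    by eventually_elim (use c(2) in auto)
  have atom: "emeasure z {p} = emeasure x {p}" if p: "p \<in> K" for p
  proof -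
    have "infinite {\<alpha>..\<beta>}" using \<alpha>\<beta> by (simp add: infinite_Icc)
    \<comment> \<open>On \<open>K\<close> this polynomial is the indicator function of \<open>{p}\<close>, hence its integral is the mass of \<open>p\<close>.\<close>
    then obtain d where d: "\<And>s. s \<in> K \<Longrightarrow> gen_poly m \<phi> d s = indicator {p} s"
      using T_system_interpolation[OF T _ K(1) KI, of "indicator {p}"] K(3) by auto
    have mass: "emeasure L {p} = ennreal (\<integral>s. gen_poly m \<phi> d s \<partial>L)"
      if L: "borel_measure_on {\<alpha>..\<beta>} L" "AE s in L. s \<in> K" "\<And>j. j < m \<Longrightarrow> integrable L (\<phi> j)" for L
    proof -
      have pL: "{p} \<in> sets L" using singleton_in_borel_measure_on[OF L(1)] p KI by auto
      have spL: "{p} \<inter> space L = {p}" using L(1) p KI by (auto simp: borel_measure_on_def)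
      have ae: "AE s in L. gen_poly m \<phi> d s = indicator {p} s"
        using L(2) by eventually_elim (use d in auto)
      have ind: "(indicator {p} :: real \<Rightarrow> real) \<in> borel_measurable L"
        using pL by simp
      have "integrable L (indicator {p} :: real \<Rightarrow> real)"
        using integrable_cong_AE[OF meas[OF L(1)] ind ae] integral_gen_poly(1)[of m L \<phi> d] L(3) by blast
      then have fin: "emeasure L {p} < \<infinity>" using spL by (simp add: integrable_indicator_iff)
      have "(\<integral>s. gen_poly m \<phi> d s \<partial>L) = (\<integral>s. indicator {p} s \<partial>L)"
        by (rule integral_cong_AE[OF meas[OF L(1)] ind ae])
      also have "\<dots> = measure L {p}" using spL by simp
      finally show ?thesis using fin by (simp add: emeasure_eq_ennreal_measure)
    qed
    show ?thesis using mass[OF x int(1)] mass[OF z zK int(2)] same by simp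
  qed
  show ?thesis
  proof (rule measure_eqI_finite_support[OF _ K(1) _ zK x(2) atom])
    show "sets z = sets x" using x(1) z by (simp add: borel_measure_on_def)
    show "{p} \<in> sets z" if "p \<in> K" for p
      using singleton_in_borel_measure_on[OF z] that KI by auto
  qed
qed

section \<open>Sums of Dirac measures\<close>

lemma AE_discrete_measure:
  assumes t: "\<And>i. i < k \<Longrightarrow> t i \<in> I"
  shows "AE s in discrete_measure I k a t. s \<in> t ` {..<k}"
proof -
  let ?x = "discrete_measure I k a t" and ?K = "t ` {..<k}"
  have x: "borel_measure_on I ?x" by (rule borel_measure_on_discrete_measure)
  have "?K = (\<Union>p\<in>?K. {p})" by simp
  also have "\<dots> \<in> sets ?x"
    using singleton_in_borel_measure_on[OF x] t by (intro sets.finite_UN) auto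
  finally have "space ?x - ?K \<in> sets ?x" by blast
  then have N: "I - ?K \<in> sets (borel_on I)" using x by (simp add: borel_measure_on_def)
  have "emeasure ?x (I - ?K) = 0"
    using N by (subst emeasure_discrete_measure[OF N]) (auto simp: indicator_def)
  then show ?thesis
    using x N by (intro AE_I[of _ _ "I - ?K"]) (auto simp: borel_measure_on_def)
qed

lemma integrable_discrete_measure:
  fixes f :: "real \<Rightarrow> 'b::{banach, second_countable_topology}"
  assumes I: "compact I" and f: "continuous_on I f"
  shows "integrable (discrete_measure I k a t) f"
proof -
  let ?x = "discrete_measure I k a t"
  have x: "borel_measure_on I ?x" by (rule borel_measure_on_discrete_measure)
  have sp: "space ?x = I" using x by (simp add: borel_measure_on_def)
  have "I \<in> sets (borel_on I)" using sets.top[of ?x] x unfolding borel_measure_on_def by metis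
  then have "emeasure ?x I \<noteq> \<infinity>"
    by (auto simp: emeasure_discrete_measure ennreal_mult_eq_top_iff indicator_def)
  then interpret finite_measure ?x by (intro finite_measureI) (simp add: sp)
  obtain B where "\<And>s. s \<in> I \<Longrightarrow> norm (f s) \<le> B"
    using compact_imp_bounded[OF compact_continuous_image[OF f I]] by (auto simp: bounded_iff)
  then show ?thesis
    by (intro integrable_const_bound[of f B] borel_measurable_borel_on[OF x f] AE_I2) (simp add: sp)
qed

theorem proposition8:
  fixes k m :: nat
    and a t y :: "nat \<Rightarrow> real"
    and \<phi> :: "nat \<Rightarrow> real \<Rightarrow> real"
    and x :: "real measure"
  assumes a_pos: "\<And>i. i < k \<Longrightarrow> a i > 0"
    and t_in: "\<And>i. i < k \<Longrightarrow> t i \<in> {0<..<1}"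
    and t_distinct: "inj_on t {..<k}"
    and x_def: "x = discrete_measure {0..1} k a t"
    and m_ge: "m \<ge> 2 * k + 1"
    and T: "T_system m \<phi> {0..1}"
    and y_def: "\<And>j. j < m \<Longrightarrow> y j = (\<integral>s. \<phi> j s \<partial>x)"
  shows "\<forall>z. borel_measure_on {0..1} z \<and>
             (\<forall>j<m. integrable z (\<phi> j) \<and> (\<integral>s. \<phi> j s \<partial>z) = y j)
           \<longleftrightarrow> z = x"
proof -
  let ?K = "t ` {..<k}"
  have K: "finite ?K" "?K \<subseteq> {0<..<1}" "2 * card ?K + 1 \<le> m"
    using t_in t_distinct m_ge by (auto simp: card_image)
  have x: "borel_measure_on {0..1} x" "AE s in x. s \<in> ?K"
    unfolding x_def using t_in
    by (auto intro!: borel_measure_on_discrete_measure AE_discrete_measure less_imp_le)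
  have int: "integrable x (\<phi> j)" if "j < m" for j
    unfolding x_def
    by (rule integrable_discrete_measure) (use T that in \<open>auto simp: T_system_def\<close>)
  show ?thesis
  proof (intro allI iffI)
    fix z assume z: "borel_measure_on {0..1} z \<and>
      (\<forall>j<m. integrable z (\<phi> j) \<and> (\<integral>s. \<phi> j s \<partial>z) = y j)"
    then show "z = x"
      by (intro finitely_supported_measure_determined_by_moments[OF T _ K x _ int])
         (auto simp: y_def)
  next
    fix z assume "z = x"
    then show "borel_measure_on {0..1} z \<and>
      (\<forall>j<m. integrable z (\<phi> j) \<and> (\<integral>s. \<phi> j s \<partial>z) = y j)"
      using x(1) int y_def by simp
  qed
qed

end
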